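(* Let $G=(V,E,w,\mu)$ be a weighted graph as in the context with $D_\mu<\infty$. Let $p>1$, $q\ge1$, and let $\psi:V\to[0,\infty)$ be bounded and not identically zero (so $\inf_V\psi\ge0$). There is a constant $C(V)>0$ depending only on the weighted graph such that the following holds. For $\lambda>0$ let $u$ be a positive solution of $$u_t-\Delta u=u^p\,|\log u|^q\ \text{ in } V\times(0,T),\qquad u(x,0)=\lambda\psi(x)\ \text{ for } x\in V,$$ and let $T_\lambda$ be its lifespan. If $x_i\in V$ is a vertex with $\deg(x_i)=m\ge1$, $$(\lambda\psi(x_i))^{p-1}\big(\log(\lambda\psi(x_i))\big)^q>C(V)\,m\quad\text{and}\quad \lambda\psi(x_i)\ge1,$$ then the lifespan is finite: $T_\lambda<\infty$. Moreover, for such a vertex $x_i$, $$\lim_{\lambda\to+\infty}(\lambda\psi(x_i))^{p-1}\big(\log(\lambda\psi(x_i))\big)^{q}T_\lambda\ \le\ \frac1{p-1}\ \le\ \lim_{\lambda\to+\infty}(\lambda\|\psi\|_\infty)^{p-1}\big(\log(\lambda\|\psi\|_\infty)\big)^{q}T_\lambda .$$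
   Context: Graph setting: $G=(V,E,w,\mu)$ is an infinite, locally finite, connected graph without loops or multiple edges, with edge weights $w_{xy}=w_{yx}>0$ for $xy\in E$ and vertex measure $\mu:V\to(0,\infty)$. Write $y\sim x$ if $xy\in E$; $\deg(x)$ is the number of neighbors of $x$. The Laplacian is $\Delta u(x)=\frac1{\mu(x)}\sum_{y\sim x}w_{xy}(u(y)-u(x))$, and $D_\mu:=\sup_{x\in V}\frac{1}{\mu(x)}\sum_{y\sim x}w_{xy}$. $\|\psi\|_\infty=\sup_{x\in V}|\psi(x)|$. Convention: $s^p|\log s|^q=0$ at $s=0$. Solutions: a (positive) solution on $[0,T)$ is a function $u$ on $V\times[0,T)$, positive on $V\times(0,T)$, such that for each $x\in V$, $u(x,\cdot)$ is continuous on $[0,T)$ and $C^1$ on $(0,T)$, the equation and initial condition hold, and $u\in L^\infty(V\times[0,T'])$ for every $0<T'<T$. The lifespan is $T_\lambda:=\sup\{T>0:\text{ the problem with initial datum }\lambda\psi\text{ admits a solution on }[0,T)\}$. *)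

theory Defs
  imports "HOL-Analysis.Analysis"
begin

text \<open>The vertex set is the whole type \<open>'v\<close>. Edges are a symmetric irreflexive
  relation, so there are no loops or multiple edges. The values of \<open>w\<close> off the
  edges are irrelevant: \<open>w\<close> is only ever summed over neighbours.\<close>

definition nbrs :: "('v \<Rightarrow> 'v \<Rightarrow> bool) \<Rightarrow> 'v \<Rightarrow> 'v set" where
  "nbrs E x = {y. E x y}"

definition deg :: "('v \<Rightarrow> 'v \<Rightarrow> bool) \<Rightarrow> 'v \<Rightarrow> nat" where
  "deg E x = card (nbrs E x)"

locale weighted_graph =
  fixes E :: "'v \<Rightarrow> 'v \<Rightarrow> bool" and w :: "'v \<Rightarrow> 'v \<Rightarrow> real" and \<mu> :: "'v \<Rightarrow> real"
  assumes infinite_verts: "infinite (UNIV :: 'v set)"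
    and edge_sym: "E x y \<Longrightarrow> E y x"
    and edge_irrefl: "\<not> E x x"
    and locally_finite: "finite (nbrs E x)"
    and connected: "E\<^sup>*\<^sup>* x y"
    and weight_pos: "E x y \<Longrightarrow> 0 < w x y"
    and weight_sym: "E x y \<Longrightarrow> w x y = w y x"
    and measure_pos: "0 < \<mu> x"

definition laplacian ::
  "('v \<Rightarrow> 'v \<Rightarrow> bool) \<Rightarrow> ('v \<Rightarrow> 'v \<Rightarrow> real) \<Rightarrow> ('v \<Rightarrow> real) \<Rightarrow> ('v \<Rightarrow> real) \<Rightarrow> 'v \<Rightarrow> real" where
  "laplacian E w \<mu> f x = (1 / \<mu> x) * (\<Sum>y\<in>nbrs E x. w x y * (f y - f x))"

definition D_mu ::
  "('v \<Rightarrow> 'v \<Rightarrow> bool) \<Rightarrow> ('v \<Rightarrow> 'v \<Rightarrow> real) \<Rightarrow> ('v \<Rightarrow> real) \<Rightarrow> ereal" where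
  "D_mu E w \<mu> = (SUP x. ereal ((1 / \<mu> x) * (\<Sum>y\<in>nbrs E x. w x y)))"

definition sup_norm :: "('v \<Rightarrow> real) \<Rightarrow> real" where
  "sup_norm f = (SUP x. \<bar>f x\<bar>)"

text \<open>\<open>u x t\<close> is a positive solution on \<open>[0,T)\<close> with initial datum \<open>u0\<close>. Since
  \<open>0 powr p = 0\<close>, the nonlinearity vanishes at \<open>0\<close>, as the usual convention demands.
  The last conjunct is membership in $L^\infty(V \times [0,T'])$; since $\mu > 0$ and each
  \<open>u x\<close> is continuous, the essential supremum is the supremum.\<close>

definition positive_solution ::
  "('v \<Rightarrow> 'v \<Rightarrow> bool) \<Rightarrow> ('v \<Rightarrow> 'v \<Rightarrow> real) \<Rightarrow> ('v \<Rightarrow> real) \<Rightarrow> real \<Rightarrow> real \<Rightarrow>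
   ('v \<Rightarrow> real) \<Rightarrow> real \<Rightarrow> ('v \<Rightarrow> real \<Rightarrow> real) \<Rightarrow> bool" where
  "positive_solution E w \<mu> p q u0 T u \<longleftrightarrow>
     (\<forall>x. \<forall>t\<in>{0<..<T}. 0 < u x t) \<and>
     (\<forall>x. continuous_on {0..<T} (u x)) \<and>
     (\<forall>x. u x C1_differentiable_on {0<..<T}) \<and>
     (\<forall>x. \<forall>t\<in>{0<..<T}.
        deriv (u x) t - laplacian E w \<mu> (\<lambda>y. u y t) x = u x t powr p * \<bar>ln (u x t)\<bar> powr q) \<and>
     (\<forall>x. u x 0 = u0 x) \<and>
     (\<forall>T'. 0 < T' \<and> T' < T \<longrightarrow> bounded {u x t | x t. t \<in> {0..T'}})"

text \<open>Restricting to finite \<open>T\<close> loses nothing: a global solution restricts to every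
  \<open>[0,T)\<close> and so makes the supremum infinite.\<close>

definition lifespan ::
  "('v \<Rightarrow> 'v \<Rightarrow> bool) \<Rightarrow> ('v \<Rightarrow> 'v \<Rightarrow> real) \<Rightarrow> ('v \<Rightarrow> real) \<Rightarrow> real \<Rightarrow> real \<Rightarrow>
   ('v \<Rightarrow> real) \<Rightarrow> ereal" where
  "lifespan E w \<mu> p q u0 =
     Sup {ereal T | T. 0 < T \<and> (\<exists>u. positive_solution E w \<mu> p q u0 T u)}"

end

(* Write f(s) = s^p |ln s|^q and F(a) = a^(p-1) (ln a)^q.

   Upper bound. At a vertex x, dropping the nonnegative inflow from the neighbours gives
   u' >= f(u) - D u, where D bounds the weighted degrees. If a = u(x,0) > 1 and F(a) > D, then u
   never drops below a, so u' >= k u^p with k = (ln a)^q - D a^(1-p) > 0, and u blows up by time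
   a^(1-p) / ((p-1) k). In particular C = D + 1 works.

   Lower bound. Let M > 1 bound the initial datum. With d = q / ln M one has
   (ln s)^q <= (ln M)^q (s/M)^d for s >= M, so the explicit solution of v' = (ln M)^q M^(-d) v^(p+d),
   v(0) = M, is a spatially constant supersolution, and it lives up to time
   M^(1-p) / ((p-1+d) (ln M)^q). Since D is finite and f + K id is monotone for some K, Picard
   iteration for exp((D+K) t) u is monotone, and it converges to a solution below v. That solution
   is positive because the graph is connected.

   As s tends to infinity, D / F(s a) and q / ln (s M) vanish. Using vertices where psi is close to
   M = |psi|, the two bounds show that F(s |psi|) T_s tends to 1/(p-1). Since F(s a) / F(s b)
   tends to (a/b)^(p-1), the limit at x is (psi(x)/|psi|)^(p-1) / (p-1). *)
theory Submission imports Defs "HOL-Real_Asymp.Real_Asymp" begin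

section \<open>The nonlinearity: continuity, and monotonicity up to a linear term\<close>

definition reaction :: "real \<Rightarrow> real \<Rightarrow> real \<Rightarrow> real" where
  "reaction p q s = s powr p * \<bar>ln s\<bar> powr q"

lemma reaction_0 [simp]: "reaction p q 0 = 0"
  by (simp add: reaction_def)

lemma reaction_nonneg: "0 \<le> reaction p q s"
  by (simp add: reaction_def)

text \<open>A logarithm is dominated by every positive power: \<open>ln_powr_bound2\<close> at
  \<open>s powr (- c)\<close>, which exceeds 1 for s < 1, gives the constant. It serves with
  exponent q for continuity at 0 and with exponent q - 1 for the derivative.\<close>

lemma powr_mult_ln_powr_bounded:
  fixes a c :: real
  assumes "c > 0" "a \<ge> 0"
  shows "\<exists>K\<ge>0. \<forall>s. 0 < s \<longrightarrow> s \<le> 1 \<longrightarrow> s powr c * \<bar>ln s\<bar> powr a \<le> K"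
proof (cases "a = 0")
  \<comment> \<open>This case arises for q = 1, where the exponent q - 1 vanishes;
    \<open>ln_powr_bound2\<close> needs a positive exponent.\<close>
  case True
  have "s powr c * \<bar>ln s\<bar> powr a \<le> 1" if "0 < s" "s \<le> 1" for s :: real
  proof -
    have "s powr c \<le> 1" using that assms(1) by (simp add: powr_le1)
    moreover have "\<bar>ln s\<bar> powr a \<le> 1" using True by simp
    ultimately show ?thesis using mult_mono[of "s powr c" 1 "\<bar>ln s\<bar> powr a" 1] by simp
  qed
  then show ?thesis by (intro exI[of _ 1]) auto
next
  case False
  with assms have a: "a > 0" by simp
  have "s powr c * \<bar>ln s\<bar> powr a \<le> a powr a / c powr a" if s: "0 < s" "s \<le> 1" for s
  proof (cases "s = 1")
    case False
    with s have s1: "s < 1" by simp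
    have "1 < s powr (- c)"
      using powr_less_mono2_neg[of "-c" s 1] s s1 assms by simp
    from ln_powr_bound2[OF this a]
    have "(- c * ln s) powr a \<le> a powr a * s powr (- c)"
      using s by (simp add: ln_powr)
    also have "- c * ln s = c * \<bar>ln s\<bar>" using s s1 by simp
    also have "(c * \<bar>ln s\<bar>) powr a = c powr a * \<bar>ln s\<bar> powr a"
      using assms by (simp add: powr_mult)
    finally have "c powr a * \<bar>ln s\<bar> powr a * s powr c \<le> a powr a * s powr (- c) * s powr c"
      by (intro mult_right_mono) auto
    also have "\<dots> = a powr a" using s by (simp add: powr_minus)
    finally show ?thesis using assms by (simp add: field_simps)
  qed simp
  then show ?thesis by (intro exI[of _ "a powr a / c powr a"]) auto
qed

text \<open>Away from 0 the formula is composed of continuous functions. At 0 it is squeezed between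
  0 and \<open>K * s\<close>, because \<open>s powr (p - 1) * \<bar>ln s\<bar> powr q\<close> stays
  bounded.\<close>

lemma continuous_on_reaction:
  assumes "p > 1" "q \<ge> 1"
  shows "continuous_on {0..} (reaction p q)"
proof -
  obtain K where K: "\<And>s. 0 < s \<Longrightarrow> s \<le> 1 \<Longrightarrow> s powr (p - 1) * \<bar>ln s\<bar> powr q \<le> K"
    using powr_mult_ln_powr_bounded[of "p - 1" q] assms by auto
  have "continuous (at s within {0..}) (reaction p q)" if "s \<ge> 0" for s
  proof (cases "s = 0")
    case True
    have "(reaction p q \<longlongrightarrow> 0) (at 0 within {0..})"
    proof (rule tendsto_sandwich[of "\<lambda>_. 0" _ _ "\<lambda>s. K * s"])
      have "\<forall>\<^sub>F s in at 0 within {0..}. s \<in> {0..} \<and> s \<noteq> 0 \<and> s < (1::real)"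
        unfolding eventually_at by (intro exI[of _ 1]) (auto simp: dist_real_def)
      then show "\<forall>\<^sub>F s in at 0 within {0..}. reaction p q s \<le> K * s"
      proof eventually_elim
        case (elim s)
        then have "s powr (p - 1) * \<bar>ln s\<bar> powr q * s \<le> K * s"
          by (intro mult_right_mono K) auto
        moreover have "s powr p = s powr (p - 1) * s"
          using elim powr_add[of s "p - 1" 1] by simp
        ultimately show ?case by (simp add: reaction_def ac_simps)
      qed
      show "((\<lambda>s. K * s) \<longlongrightarrow> 0) (at 0 within {0..})"
        by (rule tendsto_eq_intros | simp)+
    qed (simp_all add: reaction_nonneg)
    then show ?thesis using True by (simp add: continuous_within)
  next
    case False
    \<comment> \<open>At s = 1 the base of the second power is 0, so continuity there rests on q
      being positive.\<close>
    have "isCont (\<lambda>s. s powr p * \<bar>ln s\<bar> powr q) s"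
      unfolding isCont_def using False that assms
      by (intro tendsto_mult tendsto_powr2 tendsto_powr tendsto_rabs tendsto_ln tendsto_ident_at tendsto_const)
        auto
    then show ?thesis
      by (simp add: reaction_def[abs_def] continuous_at_imp_continuous_within)
  qed
  then show ?thesis by (simp add: continuous_on_eq_continuous_within)
qed

lemma reaction_mono_ge_1:
  assumes "p > 1" "q \<ge> 1" "1 \<le> a" "a \<le> b"
  shows "reaction p q a \<le> reaction p q b"
  unfolding reaction_def using assms by (intro mult_mono powr_mono2) auto

text \<open>On (0,1) the derivative of the reaction has a single negative term, whose size is q
  times the quantity bounded by K. The slope \<open>q * K\<close> of the linear term compensates
  it.\<close>

lemma reaction_add_linear_mono_01:
  assumes "p > 1" "q \<ge> 1"
    and K: "\<And>s. 0 < s \<Longrightarrow> s \<le> 1 \<Longrightarrow> s powr (p - 1) * \<bar>ln s\<bar> powr (q - 1) \<le> K"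
    and "0 < a" "a \<le> b" "b \<le> 1"
  shows "reaction p q a + q * K * a \<le> reaction p q b + q * K * b"
proof -
  let ?g = "\<lambda>s. s powr p * (- ln s) powr q + q * K * s"
  have eq: "reaction p q s + q * K * s = ?g s" if "0 < s" "s \<le> 1" for s
    using that by (simp add: reaction_def)
  have "?g a \<le> ?g b"
  \<comment> \<open>Differentiating only in the open interval avoids s = 1, where the base
    \<open>- ln s\<close> is 0.\<close>
  proof (rule DERIV_nonneg_imp_increasing_open[OF \<open>a \<le> b\<close>])
    fix s assume s: "a < s" "s < b"
    then have s0: "0 < s" "s < 1" "ln s < 0" using assms by auto
    let ?D = "p * s powr (p - 1) * (- ln s) powr q
        + s powr p * (q * (- ln s) powr (q - 1) * (- (1 / s))) + q * K"
    have "(?g has_real_derivative ?D) (at s)"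
      using s0 by (auto intro!: derivative_eq_intros simp: field_simps powr_diff)
    moreover have "0 \<le> ?D"
    proof -
      have "s powr p * (1 / s) = s powr (p - 1)" using s0 by (simp add: powr_diff)
      then have "s powr p * (q * (- ln s) powr (q - 1) * (- (1 / s)))
        = - (q * (s powr (p - 1) * (- ln s) powr (q - 1)))" by (metis minus_mult_right mult.commute mult.left_commute)
      moreover have "q * (s powr (p - 1) * (- ln s) powr (q - 1)) \<le> q * K"
        using K[of s] s0 assms by (intro mult_left_mono) auto
      moreover have "0 \<le> p * s powr (p - 1) * (- ln s) powr q" using assms by simp
      ultimately show ?thesis by linarith
    qed
    ultimately show "\<exists>y. (?g has_real_derivative y) (at s) \<and> 0 \<le> y" by blast
  next
    have "a \<le> s \<Longrightarrow> s \<noteq> 0" for s using assms by auto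
    then show "continuous_on {a..b} ?g"
      using assms by (intro continuous_intros continuous_on_powr') auto
  qed
  then show ?thesis using eq[of a] eq[of b] assms by simp
qed

text \<open>The reaction is positive on (0,1) and zero at 1, hence not monotone; a linear term
  repairs this. Below 1 the derivative bound applies, above 1 the reaction itself increases, and an
  interval containing 1 is split there.\<close>

lemma reaction_add_linear_mono:
  assumes "p > 1" "q \<ge> 1"
  obtains K where "K \<ge> 0"
    "\<And>a b. 0 \<le> a \<Longrightarrow> a \<le> b \<Longrightarrow> reaction p q a + K * a \<le> reaction p q b + K * b"
proof -
  obtain K where K0: "K \<ge> 0"
    and K: "\<And>s. 0 < s \<Longrightarrow> s \<le> 1 \<Longrightarrow> s powr (p - 1) * \<bar>ln s\<bar> powr (q - 1) \<le> K"
    using powr_mult_ln_powr_bounded[of "p - 1" "q - 1"] assms by auto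
  note low = reaction_add_linear_mono_01[OF assms K]
  have qK: "q * K \<ge> 0" using K0 assms by simp
  have high: "reaction p q a + q * K * a \<le> reaction p q b + q * K * b" if "1 \<le> a" "a \<le> b" for a b
    using reaction_mono_ge_1[OF assms that] mult_left_mono[OF that(2) qK] by simp
  have "reaction p q a + q * K * a \<le> reaction p q b + q * K * b" if ab: "0 \<le> a" "a \<le> b" for a b
  proof (cases "a = 0")
    case True
    then show ?thesis using reaction_nonneg[of p q b] qK ab by simp
  next
    case False
    then have "0 < a" using ab by simp
    consider "b \<le> 1" | "1 \<le> a" | "a \<le> 1" "1 \<le> b" by linarith
    then show ?thesis
    proof cases
      case 1
      then show ?thesis using low \<open>0 < a\<close> ab by blast
    next
      case 2
      then show ?thesis using high ab by blast
    next
      case 3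
      then show ?thesis using low[of a 1] high[of 1 b] \<open>0 < a\<close> by fastforce
    qed
  qed
  with qK that show ?thesis by blast
qed

section \<open>The Laplacian under a bound on the weighted degrees\<close>

locale degree_bounded_graph = weighted_graph +
  fixes D :: real
  assumes D_bound: "(1 / \<mu> x) * (\<Sum>y\<in>nbrs E x. w x y) \<le> D"
begin

lemma weight_nonneg: "y \<in> nbrs E x \<Longrightarrow> 0 \<le> w x y"
  using weight_pos by (force simp: nbrs_def)

lemma D_nonneg: "0 \<le> D"
proof -
  have "0 \<le> (1 / \<mu> x) * (\<Sum>y\<in>nbrs E x. w x y)" for x
    using measure_pos[of x] weight_nonneg by (simp add: sum_nonneg)
  then show ?thesis using D_bound order_trans by blast
qed

lemma laplacian_eq:
  "laplacian E w \<mu> f x =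
    (1 / \<mu> x) * (\<Sum>y\<in>nbrs E x. w x y * f y) - (1 / \<mu> x) * (\<Sum>y\<in>nbrs E x. w x y) * f x"
  by (simp add: laplacian_def right_diff_distrib sum_subtractf sum_distrib_right mult.assoc)

text \<open>The inflow from the neighbours is nonnegative and is dropped; what remains is the
  outflow, at most \<open>D * f x\<close>.\<close>

lemma laplacian_ge:
  assumes "\<And>y. 0 \<le> f y"
  shows "- D * f x \<le> laplacian E w \<mu> f x"
proof -
  have "0 \<le> (1 / \<mu> x) * (\<Sum>y\<in>nbrs E x. w x y * f y)"
    using measure_pos[of x] weight_nonneg assms by (intro mult_nonneg_nonneg sum_nonneg) (auto simp: less_imp_le)
  moreover have "(1 / \<mu> x) * (\<Sum>y\<in>nbrs E x. w x y) * f x \<le> D * f x"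
    using D_bound assms by (intro mult_right_mono)
  ultimately show ?thesis unfolding laplacian_eq by simp
qed

end

section \<open>Blow-up and the upper bound on the lifespan\<close>

text \<open>Since g never falls below a, the inequality improves to g' >= K g^p. Then g^(1-p)
  decreases at rate at least (p-1)K while staying positive, which limits T.\<close>

lemma has_derivative_ge_powr_time_bound:
  fixes g g' :: "real \<Rightarrow> real"
  assumes "p > 1" "q \<ge> 1" "D \<ge> 0" "T > 0"
    and cont: "continuous_on {0..<T} g"
    and deriv: "\<And>t. t \<in> {0<..<T} \<Longrightarrow> (g has_real_derivative g' t) (at t)"
    and ineq: "\<And>t. t \<in> {0<..<T} \<Longrightarrow> reaction p q (g t) - D * g t \<le> g' t"
    and nonneg: "\<And>t. t \<in> {0..<T} \<Longrightarrow> 0 \<le> g t"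
    and a: "a = g 0" "a > 1" "D < a powr (p - 1) * ln a powr q"
  shows "T \<le> a powr (1 - p) / ((p - 1) * (ln a powr q - D * a powr (1 - p)))"
proof -
  \<comment> \<open>For s >= a the loss \<open>D * s\<close> is at most
    \<open>D * a powr (1 - p) * s powr p\<close>, and the logarithm is at least \<open>ln a\<close>;
    K is what remains as coefficient of \<open>s powr p\<close>. The condition on D makes it
    positive.\<close>
  define K where "K = ln a powr q - D * a powr (1 - p)"
  have "D * a powr (1 - p) < a powr (p - 1) * ln a powr q * a powr (1 - p)"
    using a by (intro mult_strict_right_mono) auto
  also have "\<dots> = ln a powr q"
    using a powr_add[of a "p - 1" "1 - p"] by (simp add: ac_simps)
  finally have "K > 0" by (simp add: K_def)
  have key: "K * s powr p \<le> reaction p q s - D * s" if "a \<le> s" for s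
  proof -
    have "ln a powr q \<le> \<bar>ln s\<bar> powr q" using that assms by (intro powr_mono2) auto
    then have 1: "s powr p * ln a powr q \<le> reaction p q s"
      unfolding reaction_def by (intro mult_left_mono) auto
    have "s powr (1 - p) * s powr p \<le> a powr (1 - p) * s powr p"
      using that assms by (intro mult_right_mono powr_mono2') auto
    moreover have "s powr (1 - p) * s powr p = s"
      using that assms powr_add[of s "1 - p" p] by simp
    ultimately have "D * s \<le> D * (a powr (1 - p) * s powr p)"
      using assms by (intro mult_left_mono) auto
    with 1 show ?thesis by (simp add: K_def algebra_simps)
  qed
  have key_pos: "0 < reaction p q s - D * s" if "a \<le> s" for s
    using key[OF that] \<open>K > 0\<close> that a by (smt (verit) mult_pos_pos powr_gt_zero)
  \<comment> \<open>Otherwise there is a last time \<open>t0\<close> before t at which g is at least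
    a. The lower bound for g' is positive at \<open>t0\<close> and, by continuity, shortly after it,
    so g cannot drop below a immediately afterwards.\<close>
  have above: "a \<le> g t" if t: "t \<in> {0..<T}" for t
  proof (rule ccontr)
    assume "\<not> a \<le> g t"
    define S where "S = {s \<in> {0..t}. a \<le> g s}"
    have contt: "continuous_on {0..t} g" using cont t by (auto intro: continuous_on_subset)
    have "closed ({0..t} \<inter> g -` {a..})"
      by (intro continuous_closed_preimage contt) auto
    also have "{0..t} \<inter> g -` {a..} = S" by (auto simp: S_def)
    finally have "closed S" .
    moreover have "0 \<in> S" using t a by (simp add: S_def)
    moreover have "bdd_above S" by (rule bdd_aboveI[of _ t]) (simp add: S_def)
    ultimately have "Sup S \<in> S" using closed_contains_Sup by blast
    define t0 where "t0 = Sup S"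
    have t0: "0 \<le> t0" "t0 \<le> t" "a \<le> g t0"
      using \<open>Sup S \<in> S\<close> by (auto simp: t0_def S_def)
    then have "t0 < t" using \<open>\<not> a \<le> g t\<close> by (metis le_less)
    have below: "g s < a" if "t0 < s" "s \<le> t" for s
    proof (rule ccontr)
      assume "\<not> g s < a"
      then have "s \<in> S" using that t0 by (simp add: S_def)
      then show False using cSup_upper[OF _ \<open>bdd_above S\<close>] that by (fastforce simp: t0_def)
    qed
    have "continuous_on {t0..t} (\<lambda>s. reaction p q (g s) - D * g s)"
      using t t0 nonneg assms
      by (intro continuous_intros continuous_on_compose2[OF continuous_on_reaction]
          continuous_on_subset[OF contt]) auto
    then have "((\<lambda>s. reaction p q (g s) - D * g s) \<longlongrightarrow> reaction p q (g t0) - D * g t0) (at_right t0)"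
      using continuous_on_Icc_at_rightD \<open>t0 < t\<close> by fast
    then have "\<forall>\<^sub>F s in at_right t0. 0 < reaction p q (g s) - D * g s"
      by (rule order_tendstoD) (use key_pos t0 in auto)
    then obtain b where b: "b > t0" "\<And>s. t0 < s \<Longrightarrow> s < b \<Longrightarrow> 0 < reaction p q (g s) - D * g s"
      unfolding eventually_at_right_field by auto
    define c where "c = min b t"
    have c: "t0 < c" "c \<le> t" "c \<le> b" using b \<open>t0 < t\<close> by (auto simp: c_def)
    have "g t0 \<le> g c"
    proof (rule DERIV_nonneg_imp_increasing_open[where f = g])
      fix s assume s: "t0 < s" "s < c"
      then have "s \<in> {0<..<T}" using c t t0 by auto
      moreover have "0 < reaction p q (g s) - D * g s" using b s c by auto
      ultimately show "\<exists>y. (g has_real_derivative y) (at s) \<and> 0 \<le> y"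
        using deriv[of s] ineq[of s] by (intro exI[of _ "g' s"]) auto
    next
      show "continuous_on {t0..c} g" using c t0 by (intro continuous_on_subset[OF contt]) auto
    qed (use c in auto)
    with below[of c] c t0 show False by auto
  qed
  \<comment> \<open>The function \<open>?F\<close> below is nondecreasing, which compares
    \<open>g t powr (1 - p)\<close> with its initial value; strictness comes from the positivity of
    this power.\<close>
  have *: "(p - 1) * K * t < a powr (1 - p)" if t: "t \<in> {0<..<T}" for t
  proof -
    have "- (a powr (1 - p)) \<le> - (g t powr (1 - p) + (p - 1) * K * t)"
    proof -
      let ?F = "\<lambda>s. - (g s powr (1 - p) + (p - 1) * K * s)"
      have "?F 0 \<le> ?F t"
      proof (rule DERIV_nonneg_imp_increasing_open[where f = ?F])
        fix s assume s: "0 < s" "s < t"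
        then have sT: "s \<in> {0<..<T}" using t by auto
        then have gs: "a \<le> g s" "0 < g s" using above[of s] a by auto
        have "(?F has_real_derivative - ((1 - p) * g s powr (- p) * g' s + (p - 1) * K)) (at s)"
          using DERIV_minus[OF DERIV_add[OF DERIV_fun_powr[OF deriv[OF sT] gs(2), of "1 - p"]
                DERIV_cmult[OF DERIV_ident, of "(p - 1) * K"]]]
          by simp
        moreover have "K \<le> g s powr (- p) * g' s"
        proof -
          have "g s powr (- p) * (K * g s powr p) \<le> g s powr (- p) * g' s"
            using key[OF gs(1)] ineq[OF sT] by (intro mult_left_mono) auto
          then show ?thesis using gs by (simp add: powr_minus field_simps)
        qed
        then have "(p - 1) * K \<le> (p - 1) * (g s powr (- p) * g' s)"
          using assms by (intro mult_left_mono) auto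
        then have "0 \<le> - ((1 - p) * g s powr (- p) * g' s + (p - 1) * K)"
          by (simp add: algebra_simps)
        ultimately show "\<exists>y. (?F has_real_derivative y) (at s) \<and> 0 \<le> y" by blast
      next
        have "s \<in> {0..t} \<Longrightarrow> g s \<noteq> 0" for s using above[of s] a t by auto
        then show "continuous_on {0..t} ?F"
          using t by (intro continuous_intros continuous_on_subset[OF cont]) auto
      qed (use t in auto)
      then show ?thesis using a by simp
    qed
    moreover have "0 < g t powr (1 - p)" using above[of t] a t by auto
    ultimately show ?thesis by linarith
  qed
  have pos: "0 < (p - 1) * K" using assms \<open>K > 0\<close> by simp
  show ?thesis unfolding K_def[symmetric]
  proof (rule ccontr)
    assume "\<not> T \<le> a powr (1 - p) / ((p - 1) * K)"
    moreover have "0 < a powr (1 - p) / ((p - 1) * K)" using pos a by simp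
    ultimately show False using *[of "a powr (1 - p) / ((p - 1) * K)"] pos \<open>K > 0\<close> assms(1) by simp
  qed
qed

context degree_bounded_graph
begin

lemma positive_solution_time_bound:
  assumes "p > 1" "q \<ge> 1" "T > 0" "\<And>y. 0 \<le> u0 y"
    and sol: "positive_solution E w \<mu> p q u0 T u"
    and a: "u0 x > 1" "D < u0 x powr (p - 1) * ln (u0 x) powr q"
  shows "T \<le> u0 x powr (1 - p) / ((p - 1) * (ln (u0 x) powr q - D * u0 x powr (1 - p)))"
proof (rule has_derivative_ge_powr_time_bound[where g = "u x" and g' = "deriv (u x)"])
  note sol' = sol[unfolded positive_solution_def]
  have nonneg: "0 \<le> u y t" if "t \<in> {0..<T}" for y t
    using sol' that assms(4)[of y] by (cases "t = 0") (auto simp: less_imp_le)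
  then show "\<And>t. t \<in> {0..<T} \<Longrightarrow> 0 \<le> u x t" .
  show "continuous_on {0..<T} (u x)" using sol' by blast
  show "u0 x = u x 0" using sol' by simp
  fix t assume t: "t \<in> {0<..<T}"
  have "u x C1_differentiable_on {0<..<T}" using sol' by blast
  then have "u x differentiable (at t)" using t C1_differentiable_on_eq by blast
  then show "(u x has_real_derivative deriv (u x) t) (at t)"
    using DERIV_deriv_iff_real_differentiable by blast
  have "deriv (u x) t - laplacian E w \<mu> (\<lambda>y. u y t) x = reaction p q (u x t)"
    using sol' t by (auto simp: reaction_def)
  moreover have "- D * u x t \<le> laplacian E w \<mu> (\<lambda>y. u y t) x"
    using nonneg t by (intro laplacian_ge) auto
  ultimately show "reaction p q (u x t) - D * u x t \<le> deriv (u x) t" by simp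
qed (use assms D_nonneg in auto)

lemma lifespan_le:
  assumes "p > 1" "q \<ge> 1" "\<And>y. 0 \<le> u0 y"
    and a: "u0 x > 1" "D < u0 x powr (p - 1) * ln (u0 x) powr q"
  shows "lifespan E w \<mu> p q u0
    \<le> ereal (u0 x powr (1 - p) / ((p - 1) * (ln (u0 x) powr q - D * u0 x powr (1 - p))))"
  unfolding lifespan_def
proof (rule Sup_least)
  fix z assume "z \<in> {ereal T |T. 0 < T \<and> (\<exists>u. positive_solution E w \<mu> p q u0 T u)}"
  then obtain T u where "z = ereal T" "0 < T" "positive_solution E w \<mu> p q u0 T u" by auto
  then show "z \<le> ereal (u0 x powr (1 - p) / ((p - 1) * (ln (u0 x) powr q - D * u0 x powr (1 - p))))"
    using positive_solution_time_bound[of p q T u0 u x] assms by simp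
qed

end

section \<open>Construction of positive solutions by monotone iteration\<close>

lemma continuous_on_atLeastLessThanI:
  fixes f :: "real \<Rightarrow> 'a::topological_space"
  assumes "\<And>b. b < T \<Longrightarrow> continuous_on {a..b} f"
  shows "continuous_on {a..<T} f"
  unfolding continuous_on_eq_continuous_within
proof
  fix t assume t: "t \<in> {a..<T}"
  then obtain b where b: "t < b" "b < T" using dense by auto
  then have "continuous (at t within {a..b}) f"
    using assms[of b] t by (simp add: continuous_on_eq_continuous_within)
  moreover have "at t within {a..b} = at t within {a..<T}"
    using b t by (intro at_within_nhd[of _ "{..<b}"]) auto
  ultimately show "continuous (at t within {a..<T}) f" by simp
qed

lemma exp_mult_cancel:
  fixes c t z :: real
  shows "exp (- c * t) * (exp (c * t) * z) = z" "exp (c * t) * (exp (- c * t) * z) = z"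
  by (simp_all add: exp_minus)

locale log_reaction_graph = degree_bounded_graph +
  fixes p q K :: real
  assumes p_gt_1: "p > 1" and q_ge_1: "q \<ge> 1" and K_nonneg: "K \<ge> 0"
    and reaction_K_mono:
      "0 \<le> a \<Longrightarrow> a \<le> b \<Longrightarrow> reaction p q a + K * a \<le> reaction p q b + K * b"
begin

text \<open>The right-hand side of the equation for \<open>U = exp ((D + K) * t) * u\<close>; the factor
  \<open>D + K\<close> makes it monotone in \<open>U\<close>.\<close>

definition rate :: "'a \<Rightarrow> real \<Rightarrow> ('a \<Rightarrow> real) \<Rightarrow> real" where
  "rate x t U = (1 / \<mu> x) * (\<Sum>y\<in>nbrs E x. w x y * U y)
     + (D - (1 / \<mu> x) * (\<Sum>y\<in>nbrs E x. w x y) + K) * U x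
     + exp ((D + K) * t) * reaction p q (exp (- (D + K) * t) * U x)"

lemma rate_0 [simp]: "rate x t (\<lambda>_. 0) = 0"
  by (simp add: rate_def)

lemma rate_const:
  "rate x t (\<lambda>_. c) = (D + K) * c + exp ((D + K) * t) * reaction p q (exp (- (D + K) * t) * c)"
  unfolding rate_def sum_distrib_right[symmetric] by (simp add: ring_distribs)

text \<open>Undoes the integrating factor: if U' equals \<open>rate\<close>, the product rule for
  \<open>exp (- (D + K) * t) * U\<close> produces the left side, so this product solves the original
  equation.\<close>

lemma rate_exp:
  "exp (- (D + K) * t) * rate x t U - (D + K) * (exp (- (D + K) * t) * U x)
    = laplacian E w \<mu> (\<lambda>y. exp (- (D + K) * t) * U y) x + reaction p q (exp (- (D + K) * t) * U x)"
proof -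
  note exp_mult_cancel[of "D + K" t]
  moreover have "(\<Sum>y\<in>nbrs E x. w x y * (exp (- (D + K) * t) * U y))
      = exp (- (D + K) * t) * (\<Sum>y\<in>nbrs E x. w x y * U y)"
    by (simp add: sum_distrib_left mult.left_commute)
  ultimately show ?thesis
    unfolding laplacian_eq rate_def distrib_left by (simp only:) (simp add: algebra_simps)
qed

text \<open>All three contributions are monotone: the neighbour weights are nonnegative, D dominates
  the weighted degree, and K turns the reaction into a nondecreasing function.\<close>

lemma rate_mono:
  assumes "\<And>y. 0 \<le> U y" "\<And>y. U y \<le> V y"
  shows "rate x t U \<le> rate x t V"
proof -
  let ?e = "exp (- (D + K) * t)" and ?d = "(1 / \<mu> x) * (\<Sum>y\<in>nbrs E x. w x y)"
  have ee: "exp ((D + K) * t) * (?e * z) = z" for z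
    by (rule exp_mult_cancel)
  \<comment> \<open>The term \<open>K * W x\<close> moves inside the exponential factor, next to the
    reaction that it makes monotone.\<close>
  have split: "rate x t W = (1 / \<mu> x) * (\<Sum>y\<in>nbrs E x. w x y * W y) + (D - ?d) * W x
      + exp ((D + K) * t) * (reaction p q (?e * W x) + K * (?e * W x))" for W
    unfolding rate_def using ee[of "K * W x"] by (simp add: algebra_simps)
  have "0 \<le> 1 / \<mu> x" using measure_pos[of x] by simp
  then show ?thesis
    unfolding split using assms weight_nonneg D_bound[of x]
    by (intro add_mono mult_left_mono sum_mono reaction_K_mono) auto
qed

lemma rate_nonneg: "(\<And>y. 0 \<le> U y) \<Longrightarrow> 0 \<le> rate x t U"
  using rate_mono[of "\<lambda>_. 0" U x t] by simp

text \<open>Stated for a general filter so that it covers both continuity in time and the limit of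
  iterates at a fixed time. The sign conditions concern only x, since the reaction is evaluated only
  there.\<close>

lemma rate_tendsto:
  assumes "\<And>y. ((\<lambda>s. X s y) \<longlongrightarrow> Y y) F" "(\<tau> \<longlongrightarrow> t) F"
    and nonneg: "\<forall>\<^sub>F s in F. 0 \<le> X s x" "0 \<le> Y x"
  shows "((\<lambda>s. rate x (\<tau> s) (X s)) \<longlongrightarrow> rate x t Y) F"
proof -
  have "((\<lambda>s. reaction p q (exp (- (D + K) * \<tau> s) * X s x))
      \<longlongrightarrow> reaction p q (exp (- (D + K) * t) * Y x)) F"
  proof (rule continuous_on_tendsto_compose[OF continuous_on_reaction[OF p_gt_1 q_ge_1]])
    show "((\<lambda>s. exp (- (D + K) * \<tau> s) * X s x) \<longlongrightarrow> exp (- (D + K) * t) * Y x) F"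
      by (intro tendsto_intros assms)
    show "\<forall>\<^sub>F s in F. exp (- (D + K) * \<tau> s) * X s x \<in> {0..}"
      using nonneg(1) by eventually_elim simp
  qed (use nonneg in simp)
  then show ?thesis unfolding rate_def by (intro tendsto_intros assms)
qed

lemma continuous_on_rate:
  assumes "\<And>y. continuous_on S (U y)" "\<And>t. t \<in> S \<Longrightarrow> 0 \<le> U x t"
  shows "continuous_on S (\<lambda>s. rate x s (\<lambda>y. U y s))"
  unfolding continuous_on_def
proof
  fix t assume t: "t \<in> S"
  show "((\<lambda>s. rate x s (\<lambda>y. U y s)) \<longlongrightarrow> rate x t (\<lambda>y. U y t)) (at t within S)"
  proof (rule rate_tendsto)
    show "\<forall>\<^sub>F s in at t within S. 0 \<le> U x s"
      using assms(2) by (auto simp: eventually_at intro: exI[of _ 1])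
  qed (use assms t in \<open>auto simp: continuous_on_def\<close>)
qed

text \<open>Starting from 0 rather than from \<open>u0\<close> reduces the first monotonicity step
  to nonnegativity of the iterates.\<close>

primrec picard :: "('a \<Rightarrow> real) \<Rightarrow> nat \<Rightarrow> 'a \<Rightarrow> real \<Rightarrow> real" where
  "picard u0 0 = (\<lambda>x t. 0)"
| "picard u0 (Suc n) = (\<lambda>x t. u0 x + integral {0..t} (\<lambda>s. rate x s (\<lambda>y. picard u0 n y s)))"

text \<open>Monotonicity of \<open>rate\<close> carries the bounds 0 and V through the integral, and
  \<open>super\<close> closes the induction. Continuity is part of the same induction because it
  supplies integrability for the next iterate.\<close>

lemma picard_bounds:
  assumes u0: "\<And>x. 0 \<le> u0 x"
    and V: "continuous_on {0..<T} V" "\<And>t. t \<in> {0..<T} \<Longrightarrow> 0 \<le> V t"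
    and super: "\<And>x t. t \<in> {0..<T} \<Longrightarrow> u0 x + integral {0..t} (\<lambda>s. rate x s (\<lambda>_. V s)) \<le> V t"
  shows "continuous_on {0..<T} (picard u0 n x)
    \<and> (\<forall>t\<in>{0..<T}. 0 \<le> picard u0 n x t \<and> picard u0 n x t \<le> V t)"
proof (induction n arbitrary: x)
  case 0
  then show ?case using V by simp
next
  case (Suc n)
  let ?R = "\<lambda>s. rate x s (\<lambda>y. picard u0 n y s)" and ?RV = "\<lambda>s. rate x s (\<lambda>_. V s)"
  have cR: "continuous_on {0..<T} ?R" and cV: "continuous_on {0..<T} ?RV"
    using Suc V by (intro continuous_on_rate; auto)+
  have int: "?R integrable_on {0..b}" "?RV integrable_on {0..b}" if "b < T" for b
    using that
    by (auto intro!: integrable_continuous_interval intro: continuous_on_subset[OF cR] continuous_on_subset[OF cV])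
  have "continuous_on {0..<T} (picard u0 (Suc n) x)"
    unfolding picard.simps
    by (intro continuous_on_atLeastLessThanI continuous_on_add continuous_on_const
        indefinite_integral_continuous_1 int)
  moreover have "0 \<le> picard u0 (Suc n) x t" if t: "t \<in> {0..<T}" for t
    unfolding picard.simps using Suc t u0[of x] int[of t]
    by (intro add_nonneg_nonneg integral_nonneg rate_nonneg) auto
  moreover have "picard u0 (Suc n) x t \<le> V t" if t: "t \<in> {0..<T}" for t
  proof -
    have "integral {0..t} ?R \<le> integral {0..t} ?RV"
      using Suc t int[of t] by (intro integral_le rate_mono) auto
    with super[OF t, of x] show ?thesis by simp
  qed
  ultimately show ?case by blast
qed

text \<open>The iterates increase and stay below V, so they converge pointwise. Dominated
  convergence, with the rate of V as majorant, passes the limit through the integral.\<close>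

lemma monotone_iteration:
  assumes u0: "\<And>x. 0 \<le> u0 x"
    and V: "continuous_on {0..<T} V" "\<And>t. t \<in> {0..<T} \<Longrightarrow> 0 \<le> V t"
    and super: "\<And>x t. t \<in> {0..<T} \<Longrightarrow> u0 x + integral {0..t} (\<lambda>s. rate x s (\<lambda>_. V s)) \<le> V t"
  obtains U where "\<And>x. continuous_on {0..<T} (U x)"
    "\<And>x t. t \<in> {0..<T} \<Longrightarrow> 0 \<le> U x t" "\<And>x t. t \<in> {0..<T} \<Longrightarrow> U x t \<le> V t"
    "\<And>x t. t \<in> {0..<T} \<Longrightarrow> U x t = u0 x + integral {0..t} (\<lambda>s. rate x s (\<lambda>y. U y s))"
proof -
  note bounds = picard_bounds[OF assms]
  let ?P = "picard u0"
  have P: "0 \<le> ?P n x t" "?P n x t \<le> V t" if "t \<in> {0..<T}" for n x t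
    using bounds that by auto
  have cR: "continuous_on {0..t} (\<lambda>s. rate x s (\<lambda>y. ?P n y s))" if "t < T" for n x t
    using bounds that by (intro continuous_on_rate) (auto intro: continuous_on_subset[of "{0..<T}"])
  have cRV: "continuous_on {0..t} (\<lambda>s. rate x s (\<lambda>_. V s))" if "t < T" for x t
    using V that by (intro continuous_on_rate) (auto intro: continuous_on_subset[of "{0..<T}"])
  have mono: "?P n x t \<le> ?P (Suc n) x t" if "t \<in> {0..<T}" for n x t
    using that
  proof (induction n arbitrary: x t)
    case 0
    then show ?case using P(1)[of t "Suc 0" x] by simp
  next
    case (Suc n)
    have "integral {0..t} (\<lambda>s. rate x s (\<lambda>y. ?P n y s))
      \<le> integral {0..t} (\<lambda>s. rate x s (\<lambda>y. ?P (Suc n) y s))"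
      using Suc P(1) cR[of t x n] cR[of t x "Suc n"]
      by (intro integral_le rate_mono integrable_continuous_interval) auto
    then show ?case by simp
  qed
  define U where "U x t = lim (\<lambda>n. ?P n x t)" for x t
  have lim: "(\<lambda>n. ?P n x t) \<longlonglongrightarrow> U x t" if "t \<in> {0..<T}" for x t
  proof -
    have "incseq (\<lambda>n. ?P n x t)" using mono that by (intro incseq_SucI)
    moreover have "\<forall>n. ?P n x t \<le> V t" using P that by blast
    ultimately have "convergent (\<lambda>n. ?P n x t)"
      using incseq_convergent by (metis convergent_def)
    then show ?thesis by (simp add: U_def convergent_LIMSEQ_iff)
  qed
  have U: "0 \<le> U x t" "U x t \<le> V t" if "t \<in> {0..<T}" for x t
    using LIMSEQ_le_const[OF lim[OF that]] LIMSEQ_le_const2[OF lim[OF that]] P[OF that] by blast+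
  have conv: "(\<lambda>s. rate x s (\<lambda>y. U y s)) integrable_on {0..t}"
    "(\<lambda>n. integral {0..t} (\<lambda>s. rate x s (\<lambda>y. ?P n y s)))
      \<longlonglongrightarrow> integral {0..t} (\<lambda>s. rate x s (\<lambda>y. U y s))" if t: "t < T" for x t
  proof -
    have int: "(\<lambda>s. rate x s (\<lambda>y. ?P n y s)) integrable_on {0..t}" for n
      using cR[OF t] by (rule integrable_continuous_interval)
    have intV: "(\<lambda>s. rate x s (\<lambda>_. V s)) integrable_on {0..t}"
      using cRV[OF t] by (rule integrable_continuous_interval)
    have le: "norm (rate x s (\<lambda>y. ?P n y s)) \<le> rate x s (\<lambda>_. V s)" if "s \<in> {0..t}" for n s
      using that t P rate_nonneg[of "\<lambda>y. ?P n y s" x s] rate_mono[of "\<lambda>y. ?P n y s" "\<lambda>_. V s" x s]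
      by auto
    have lim': "(\<lambda>n. rate x s (\<lambda>y. ?P n y s)) \<longlonglongrightarrow> rate x s (\<lambda>y. U y s)" if "s \<in> {0..t}" for s
      using that t lim P U by (intro rate_tendsto tendsto_const) auto
    show "(\<lambda>s. rate x s (\<lambda>y. U y s)) integrable_on {0..t}"
      "(\<lambda>n. integral {0..t} (\<lambda>s. rate x s (\<lambda>y. ?P n y s)))
      \<longlonglongrightarrow> integral {0..t} (\<lambda>s. rate x s (\<lambda>y. U y s))"
      using dominated_convergence[OF int intV le lim'] by blast+
  qed
  have eq: "U x t = u0 x + integral {0..t} (\<lambda>s. rate x s (\<lambda>y. U y s))" if t: "t \<in> {0..<T}" for x t
  proof (rule LIMSEQ_unique)
    show "(\<lambda>n. ?P (Suc n) x t) \<longlonglongrightarrow> U x t" using lim[OF t] by (rule LIMSEQ_Suc)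
    show "(\<lambda>n. ?P (Suc n) x t) \<longlonglongrightarrow> u0 x + integral {0..t} (\<lambda>s. rate x s (\<lambda>y. U y s))"
      using t by (simp add: tendsto_add conv)
  qed
  \<comment> \<open>A pointwise limit need not be continuous; continuity of U is read off from its
    integral equation.\<close>
  have "continuous_on {0..<T} (\<lambda>t. u0 x + integral {0..t} (\<lambda>s. rate x s (\<lambda>y. U y s)))" for x
    by (intro continuous_on_atLeastLessThanI continuous_on_add continuous_on_const
        indefinite_integral_continuous_1 conv)
  then have "continuous_on {0..<T} (U x)" for x
    by (rule continuous_on_eq) (rule eq[symmetric])
  with U eq that show thesis by blast
qed

text \<open>The spatially constant supersolution v, multiplied by the integrating factor, is the
  barrier V for the iteration. Undoing the factor in the limit U gives the solution.\<close>

lemma exists_positive_solution: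
  assumes u0: "\<And>x. 0 \<le> u0 x" "0 < u0 x0" and "T > 0"
    and v: "\<And>t. t \<in> {0..<T} \<Longrightarrow> (v has_real_derivative v' t) (at t)"
      "\<And>t. t \<in> {0..<T} \<Longrightarrow> reaction p q (v t) \<le> v' t"
      "\<And>t. t \<in> {0..<T} \<Longrightarrow> 0 \<le> v t" "\<And>x. u0 x \<le> v 0"
  shows "\<exists>u. positive_solution E w \<mu> p q u0 T u"
proof -
  let ?L = "D + K"
  define V where "V t = exp (?L * t) * v t" for t
  define V' where "V' t = ?L * V t + exp (?L * t) * v' t" for t
  have dV: "(V has_real_derivative V' t) (at t)" if "t \<in> {0..<T}" for t
    unfolding V_def[abs_def] V'_def using v(1)[OF that]
    by (auto intro!: derivative_eq_intros simp: V_def algebra_simps)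
  have cV: "continuous_on {0..<T} V"
    using dV by (meson DERIV_continuous continuous_at_imp_continuous_on)
  have Vnn: "0 \<le> V t" if "t \<in> {0..<T}" for t using v(3)[OF that] by (simp add: V_def)
  \<comment> \<open>For a function constant in space the Laplacian vanishes, so the differential
    inequality for v integrates to this one.\<close>
  have super: "u0 x + integral {0..t} (\<lambda>s. rate x s (\<lambda>_. V s)) \<le> V t" if t: "t \<in> {0..<T}" for x t
  proof -
    have cRV: "continuous_on {0..t} (\<lambda>s. rate x s (\<lambda>_. V s))"
      using t Vnn by (intro continuous_on_rate continuous_on_subset[OF cV]) auto
    have FTC: "(V' has_integral V t - V 0) {0..t}"
      using t dV
      by (intro fundamental_theorem_of_calculus)
        (auto simp: has_real_derivative_iff_has_vector_derivative[symmetric] intro: has_field_derivative_at_within)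
    have "integral {0..t} (\<lambda>s. rate x s (\<lambda>_. V s)) \<le> V t - V 0"
    proof (rule has_integral_le[OF integrable_integral FTC])
      show "(\<lambda>s. rate x s (\<lambda>_. V s)) integrable_on {0..t}"
        using cRV by (rule integrable_continuous_interval)
      fix s assume s: "s \<in> {0..t}"
      have "exp (- ?L * s) * V s = v s"
        unfolding V_def by (rule exp_mult_cancel)
      then have "rate x s (\<lambda>_. V s) = ?L * V s + exp (?L * s) * reaction p q (v s)"
        by (simp add: rate_const)
      then show "rate x s (\<lambda>_. V s) \<le> V' s" using v(2)[of s] s t by (simp add: V'_def)
    qed
    moreover have "V 0 = v 0" by (simp add: V_def)
    ultimately show ?thesis using v(4)[of x] by simp
  qed
  obtain U where cU: "\<And>x. continuous_on {0..<T} (U x)"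
    and U_nonneg: "\<And>x t. t \<in> {0..<T} \<Longrightarrow> 0 \<le> U x t"
    and U_le: "\<And>x t. t \<in> {0..<T} \<Longrightarrow> U x t \<le> V t"
    and U_eq: "\<And>x t. t \<in> {0..<T} \<Longrightarrow> U x t = u0 x + integral {0..t} (\<lambda>s. rate x s (\<lambda>y. U y s))"
    using monotone_iteration[OF u0(1) cV Vnn super] by blast
  define R where "R x s = rate x s (\<lambda>y. U y s)" for x s
  have cR: "continuous_on {0..<T} (R x)" for x
    unfolding R_def using cU U_nonneg by (intro continuous_on_rate) auto
  have dU: "(U x has_real_derivative R x t) (at t)" if t: "t \<in> {0<..<T}" for x t
  proof -
    \<comment> \<open>A point b beyond t makes t interior to \<open>{0..b}\<close>, so the
      derivative within that interval is two-sided.\<close>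
    obtain b where b: "t < b" "b < T" using t dense by auto
    have "continuous_on {0..b} (R x)" using b by (intro continuous_on_subset[OF cR]) auto
    then have "((\<lambda>t. integral {0..t} (R x)) has_real_derivative R x t) (at t within {0..b})"
      using b t by (intro integral_has_real_derivative) auto
    then have "((\<lambda>t. integral {0..t} (R x)) has_real_derivative R x t) (at t)"
      using b t by (simp add: at_within_Icc_at)
    then have "((\<lambda>t. u0 x + integral {0..t} (R x)) has_real_derivative R x t) (at t)"
      by (auto intro!: derivative_eq_intros)
    then show ?thesis
      by (rule has_field_derivative_transform_within_open[of _ _ _ "{0<..<T}"])
        (use t U_eq in \<open>auto simp: R_def[abs_def]\<close>)
  qed
  have U0: "U x 0 = u0 x" for x using U_eq[of 0 x] \<open>T > 0\<close> by simp
  have R_nonneg: "0 \<le> R x t" if "t \<in> {0..<T}" for x t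
    unfolding R_def using U_nonneg that by (intro rate_nonneg) auto
  \<comment> \<open>Positivity spreads along a path from \<open>x0\<close>. At \<open>x0\<close> the
    integral only adds to a positive datum; at a later vertex the positive inflow from its
    predecessor makes U strictly increasing.\<close>
  have U_pos: "0 < U x t" if t: "t \<in> {0<..<T}" for x t
  proof -
    have "E\<^sup>*\<^sup>* x0 x" by (rule connected)
    then have "\<forall>t\<in>{0<..<T}. 0 < U x t"
    proof (induction rule: rtranclp_induct)
      case base
      have "0 \<le> integral {0..t} (R x0)" if "t \<in> {0<..<T}" for t
        using that R_nonneg
        by (intro integral_nonneg integrable_continuous_interval continuous_on_subset[OF cR]) auto
      then show ?case using U_eq[of _ x0] u0(2) by (fastforce simp: R_def[abs_def])
    next
      case (step y z)
      show ?case
      proof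
        fix t assume t: "t \<in> {0<..<T}"
        have R_pos: "0 < R z s" if s: "s \<in> {0<..<T}" for s
        proof -
          have y: "y \<in> nbrs E z" using step edge_sym by (simp add: nbrs_def)
          have "0 < (1 / \<mu> z) * (w z y * U y s)"
            using step.IH s measure_pos weight_pos y by (simp add: nbrs_def)
          \<comment> \<open>The comparison function keeps only the value at y. Since y differs from
            z, its rate at z is exactly the inflow along one edge.\<close>
          also have "\<dots> \<le> rate z s (\<lambda>x. if x = y then U y s else 0)"
          proof -
            have "y \<noteq> z" using y edge_irrefl by (auto simp: nbrs_def)
            then show ?thesis using y locally_finite
              by (simp add: rate_def if_distrib cong: if_cong)
          qed
          also have "\<dots> \<le> R z s"
            unfolding R_def using U_nonneg s by (intro rate_mono) auto
          finally show ?thesis .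
        qed
        have "U z 0 < U z t"
        proof (rule DERIV_pos_imp_increasing_open[where f = "U z"])
          show "continuous_on {0..t} (U z)" using t by (intro continuous_on_subset[OF cU]) auto
          show "\<exists>y. (U z has_real_derivative y) (at s) \<and> 0 < y" if "0 < s" "s < t" for s
            using dU[of s z] R_pos[of s] that t by auto
        qed (use t in auto)
        then show "0 < U z t" using U0 u0(1)[of z] by simp
      qed
    qed
    with t show ?thesis by blast
  qed
  define u where "u x t = exp (- ?L * t) * U x t" for x t
  have du: "(u x has_real_derivative exp (- ?L * t) * R x t - ?L * u x t) (at t)"
    if "t \<in> {0<..<T}" for x t
    unfolding u_def[abs_def] using dU[OF that, of x]
    by (auto intro!: derivative_eq_intros simp: algebra_simps)
  have cu: "continuous_on {0..<T} (u x)" for x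
    unfolding u_def[abs_def] by (intro continuous_intros cU)
  have "positive_solution E w \<mu> p q u0 T u"
    unfolding positive_solution_def
  proof (intro conjI allI ballI impI)
    show "0 < u x t" if "t \<in> {0<..<T}" for x t using U_pos[OF that] by (simp add: u_def)
    show "continuous_on {0..<T} (u x)" for x by (rule cu)
    show "u x C1_differentiable_on {0<..<T}" for x
      unfolding C1_differentiable_on_def
    proof (intro exI conjI ballI)
      show "(u x has_vector_derivative exp (- ?L * t) * R x t - ?L * u x t) (at t)"
        if "t \<in> {0<..<T}" for t
        using du[OF that] by (simp add: has_real_derivative_iff_has_vector_derivative)
      show "continuous_on {0<..<T} (\<lambda>t. exp (- ?L * t) * R x t - ?L * u x t)"
        by (intro continuous_intros continuous_on_subset[OF cu] continuous_on_subset[OF cR]) auto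
    qed
    show "deriv (u x) t - laplacian E w \<mu> (\<lambda>y. u y t) x = u x t powr p * \<bar>ln (u x t)\<bar> powr q"
      if "t \<in> {0<..<T}" for x t
      using DERIV_imp_deriv[OF du[OF that, of x]] rate_exp[of t x "\<lambda>y. U y t"]
      by (simp add: u_def R_def reaction_def)
    show "u x 0 = u0 x" for x by (simp add: u_def U0)
    \<comment> \<open>The bound v does not depend on the vertex and is continuous on the compact
      interval, so it bounds u uniformly.\<close>
    show "bounded {u x t |x t. t \<in> {0..T'}}" if T': "0 < T' \<and> T' < T" for T'
    proof -
      have "compact (v ` {0..T'})"
        using T' by (intro compact_continuous_image continuous_at_imp_continuous_on)
          (auto intro!: DERIV_isCont[OF v(1)])
      then obtain B where B: "\<And>t. t \<in> {0..T'} \<Longrightarrow> norm (v t) \<le> B"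
        using compact_imp_bounded bounded_iff by (metis imageI)
      have "norm (u x t) \<le> B" if t: "t \<in> {0..T'}" for x t
      proof -
        have tT: "t \<in> {0..<T}" using t T' by auto
        have "u x t \<le> exp (- ?L * t) * V t"
          unfolding u_def using U_le[OF tT] by (intro mult_left_mono) auto
        also have "\<dots> = v t" unfolding V_def by (rule exp_mult_cancel)
        finally show ?thesis using B[OF t] U_nonneg[OF tT, of x] by (simp add: u_def)
      qed
      then show ?thesis by (auto simp: bounded_iff)
    qed
  qed
  then show ?thesis by blast
qed

end

section \<open>An explicit supersolution constant in space\<close>

text \<open>This is 1 + x <= exp x at x = ln (s/M) / ln M, raised to the power q. The price is the
  extra exponent \<open>q / ln M\<close>, which tends to 0 as M grows.\<close>

lemma ln_powr_le_powr:
  fixes M s q :: real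
  assumes "1 < M" "M \<le> s" "0 \<le> q"
  shows "ln s powr q \<le> ln M powr q * (s / M) powr (q / ln M)"
proof -
  have M: "0 < ln M" using assms by simp
  have "ln s / ln M = 1 + ln (s / M) / ln M"
    using assms M by (simp add: ln_div field_simps)
  also have "\<dots> \<le> exp (ln (s / M) / ln M)" by (rule exp_ge_add_one_self)
  finally have "(ln s / ln M) powr q \<le> exp (ln (s / M) / ln M) powr q"
    using assms M by (intro powr_mono2) auto
  also have "\<dots> = (s / M) powr (q / ln M)"
    using assms by (simp add: powr_def)
  finally have "ln M powr q * (ln s / ln M) powr q \<le> ln M powr q * (s / M) powr (q / ln M)"
    by (intro mult_left_mono) auto
  moreover have "ln M powr q * (ln s / ln M) powr q = ln s powr q"
    using assms M by (simp add: powr_mult[symmetric])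
  ultimately show ?thesis by simp
qed

text \<open>Above M the reaction is at most \<kappa> s^(1+r), and v' = \<kappa> v^(1+r) is solved in
  closed form. As v stays above M, the comparison holds throughout.\<close>

lemma reaction_supersolution:
  fixes p q M :: real
  assumes "p > 1" "q \<ge> 1" "M > 1"
  defines "T \<equiv> M powr (1 - p) / ((p - 1 + q / ln M) * ln M powr q)"
  obtains v v' where "v 0 = M" "\<And>t. t \<in> {0..<T} \<Longrightarrow> (v has_real_derivative v' t) (at t)"
    "\<And>t. t \<in> {0..<T} \<Longrightarrow> reaction p q (v t) \<le> v' t" "\<And>t. t \<in> {0..<T} \<Longrightarrow> 0 \<le> v t"
proof -
  define \<delta> where "\<delta> = q / ln M"
  define r where "r = p - 1 + \<delta>"
  define \<kappa> where "\<kappa> = ln M powr q * M powr (- \<delta>)"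
  \<comment> \<open>This is v^(-r), which is affine in t along solutions of that equation; T is its
    zero.\<close>
  define z where "z t = M powr (- r) - r * \<kappa> * t" for t
  define v where "v t = z t powr (- 1 / r)" for t
  have pos: "0 < ln M" "0 \<le> \<delta>" "0 < r" "0 < \<kappa>"
    using assms by (auto simp: \<delta>_def r_def \<kappa>_def add_pos_nonneg)
  have "M powr (- r) = M powr (1 - p) * M powr (- \<delta>)"
    by (simp add: r_def powr_add[symmetric])
  then have T: "T * (r * \<kappa>) = M powr (- r)"
    using pos assms by (simp add: T_def r_def \<kappa>_def \<delta>_def)
  have z: "0 < z t" "z t \<le> M powr (- r)" if "t \<in> {0..<T}" for t
  proof -
    have "t * (r * \<kappa>) < M powr (- r)"
      unfolding T[symmetric] using that pos by (intro mult_strict_right_mono) auto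
    then show "0 < z t" by (simp add: z_def ac_simps)
    show "z t \<le> M powr (- r)" using that pos by (simp add: z_def)
  qed
  have v0: "v 0 = M" using assms pos by (simp add: v_def z_def powr_powr)
  have vM: "M \<le> v t" if "t \<in> {0..<T}" for t
  proof -
    have "(M powr (- r)) powr (- 1 / r) \<le> z t powr (- 1 / r)"
      using z[OF that] pos by (intro powr_mono2') auto
    then show ?thesis using assms pos by (simp add: v_def powr_powr)
  qed
  have dv: "(v has_real_derivative \<kappa> * v t powr (1 + r)) (at t)" if "t \<in> {0..<T}" for t
  proof -
    have "(z has_real_derivative - (r * \<kappa>)) (at t)"
      unfolding z_def[abs_def] by (auto intro!: derivative_eq_intros)
    from DERIV_fun_powr[OF this z(1)[OF that], of "- 1 / r"]
    have "(v has_real_derivative \<kappa> * z t powr (- 1 / r - 1)) (at t)"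
      using pos by (simp add: v_def[abs_def] mult.commute)
    moreover have "- 1 / r - 1 = - 1 / r * (1 + r)" using pos by (simp add: field_simps)
    ultimately show ?thesis by (simp only: v_def powr_powr)
  qed
  have super: "reaction p q (v t) \<le> \<kappa> * v t powr (1 + r)" if t: "t \<in> {0..<T}" for t
  proof -
    have "\<bar>ln (v t)\<bar> powr q \<le> ln M powr q * (v t / M) powr \<delta>"
      using ln_powr_le_powr[of M "v t" q] vM[OF t] assms by (simp add: \<delta>_def)
    also have "\<dots> = \<kappa> * v t powr \<delta>"
      using vM[OF t] assms by (simp add: \<kappa>_def powr_divide powr_minus field_simps)
    finally have "reaction p q (v t) \<le> v t powr p * (\<kappa> * v t powr \<delta>)"
      unfolding reaction_def by (intro mult_left_mono) auto
    also have "\<dots> = \<kappa> * v t powr (1 + r)"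
      by (simp add: r_def powr_add)
    finally show ?thesis .
  qed
  show thesis
    using that[of v, OF v0 dv super] vM assms by fastforce
qed

section \<open>Asymptotics of the blow-up scale\<close>

text \<open>For a > 1 this is \<open>reaction p q a / a\<close>, the relative growth rate at the
  value a; its reciprocal is the time scale of blow-up.\<close>

definition growth :: "real \<Rightarrow> real \<Rightarrow> real \<Rightarrow> real" where
  "growth p q a = a powr (p - 1) * ln a powr q"

lemma growth_pos: "a > 1 \<Longrightarrow> 0 < growth p q a"
  by (simp add: growth_def)

lemma filterlim_growth:
  assumes "p > 1" "q \<ge> 1" "a > 0"
  shows "filterlim (\<lambda>s. growth p q (s * a)) at_top at_top"
  unfolding growth_def using assms by real_asymp

text \<open>The quotient of the two logarithms tends to 1, so only the quotient of the powers
  survives.\<close>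

lemma tendsto_growth_ratio:
  assumes "p > 1" "q \<ge> 1" "a > 0" "b > 0"
  shows "((\<lambda>s. growth p q (s * a) / growth p q (s * b)) \<longlongrightarrow> (a / b) powr (p - 1)) at_top"
proof (rule Lim_transform_eventually)
  have "((\<lambda>s. ln (s * a) / ln (s * b)) \<longlongrightarrow> 1) at_top"
    using assms by real_asymp
  then have "((\<lambda>s. (a / b) powr (p - 1) * (ln (s * a) / ln (s * b)) powr q)
      \<longlongrightarrow> (a / b) powr (p - 1) * 1 powr q) at_top"
    by (intro tendsto_intros) auto
  then show "((\<lambda>s. (a / b) powr (p - 1) * (ln (s * a) / ln (s * b)) powr q)
      \<longlongrightarrow> (a / b) powr (p - 1)) at_top" by simp
  show "\<forall>\<^sub>F s in at_top. (a / b) powr (p - 1) * (ln (s * a) / ln (s * b)) powr q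
      = growth p q (s * a) / growth p q (s * b)"
    using eventually_gt_at_top[of "max (1 / a) (1 / b)"]
  proof eventually_elim
    case (elim s)
    then have "1 < s * a" "1 < s * b" using assms by (auto simp: field_simps)
    moreover from this have "0 < s" using assms by (smt (verit) mult_nonpos_nonneg)
    ultimately show ?case using assms
      by (simp add: growth_def powr_divide powr_mult field_simps)
  qed
qed

section \<open>Two-sided lifespan bounds and their limits\<close>

context degree_bounded_graph
begin

text \<open>Rearranges \<open>lifespan_le\<close> so that the outflow enters only through
  \<open>D / growth p q (u0 x)\<close>, which vanishes for large data.\<close>

lemma growth_lifespan_le:
  assumes "p > 1" "q \<ge> 1" "\<And>y. 0 \<le> u0 y" "u0 x > 1" "D < growth p q (u0 x)"
    and l: "lifespan E w \<mu> p q u0 = ereal l"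
  shows "growth p q (u0 x) * l \<le> 1 / ((p - 1) * (1 - D / growth p q (u0 x)))"
proof -
  define a where "a = u0 x"
  define P where "P = a powr (p - 1)"
  define Q where "Q = ln a powr q"
  have pos: "P > 0" "Q > 0" and PQ: "D < P * Q"
    using assms by (auto simp: P_def Q_def a_def growth_def)
  have P': "a powr (1 - p) = 1 / P"
    using powr_minus_divide[of a "p - 1"] by (simp add: P_def)
  have "l \<le> 1 / P / ((p - 1) * (Q - D * (1 / P)))"
    using lifespan_le[of p q u0 x] assms P' by (simp add: a_def P_def Q_def growth_def)
  then have "P * Q * l \<le> P * Q * (1 / P / ((p - 1) * (Q - D * (1 / P))))"
    using pos by (intro mult_left_mono) auto
  also have "Q - D * (1 / P) = Q * (1 - D / (P * Q))"
    using pos by (simp add: field_simps)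
  also have "P * Q * (1 / P / ((p - 1) * (Q * (1 - D / (P * Q))))) = 1 / ((p - 1) * (1 - D / (P * Q)))"
    using pos by simp
  finally show ?thesis by (simp add: growth_def P_def Q_def a_def)
qed

text \<open>A solution exists at least as long as the supersolution started at M. One vertex
  \<open>x0\<close> with positive datum is enough for positivity everywhere, by
  connectedness.\<close>

lemma lifespan_ge:
  assumes "p > 1" "q \<ge> 1" "\<And>y. 0 \<le> u0 y" "0 < u0 x0" "\<And>y. u0 y \<le> M" "M > 1"
  shows "ereal (M powr (1 - p) / ((p - 1 + q / ln M) * ln M powr q)) \<le> lifespan E w \<mu> p q u0"
proof -
  let ?T = "M powr (1 - p) / ((p - 1 + q / ln M) * ln M powr q)"
  obtain v v' where v: "v 0 = M" "\<And>t. t \<in> {0..<?T} \<Longrightarrow> (v has_real_derivative v' t) (at t)"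
    "\<And>t. t \<in> {0..<?T} \<Longrightarrow> reaction p q (v t) \<le> v' t" "\<And>t. t \<in> {0..<?T} \<Longrightarrow> 0 \<le> v t"
    using reaction_supersolution[OF assms(1,2,6)] by blast
  obtain K where K: "K \<ge> 0"
    "\<And>a b. 0 \<le> a \<Longrightarrow> a \<le> b \<Longrightarrow> reaction p q a + K * a \<le> reaction p q b + K * b"
    using reaction_add_linear_mono[OF assms(1,2)] by blast
  interpret log_reaction_graph E w \<mu> D p q K
    using assms K by unfold_locales
  have T: "?T > 0" using assms by (auto intro!: divide_pos_pos mult_pos_pos add_pos_nonneg)
  have "\<exists>u. positive_solution E w \<mu> p q u0 ?T u"
    using exists_positive_solution[of u0, OF assms(3,4) T v(2-4)] assms(5) v(1) by simp
  with T show ?thesis unfolding lifespan_def by (intro Sup_upper) blast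
qed

lemma growth_lifespan_ge:
  assumes "p > 1" "q \<ge> 1" "\<And>y. 0 \<le> u0 y" "0 < u0 x0" "\<And>y. u0 y \<le> M" "M > 1"
    and l: "lifespan E w \<mu> p q u0 = ereal l"
  shows "1 / (p - 1 + q / ln M) \<le> growth p q M * l"
proof -
  have "M powr (1 - p) / ((p - 1 + q / ln M) * ln M powr q) \<le> l"
    using lifespan_ge[of p q u0, OF assms(1-6)] l by simp
  then have "growth p q M * (M powr (1 - p) / ((p - 1 + q / ln M) * ln M powr q)) \<le> growth p q M * l"
    using growth_pos[OF assms(6)] by (intro mult_left_mono) (auto simp: less_imp_le)
  moreover have "M powr (p - 1) * M powr (1 - p) = 1"
    using assms powr_add[of M "p - 1" "1 - p"] by simp
  then have "growth p q M * (M powr (1 - p) / ((p - 1 + q / ln M) * ln M powr q))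
      = 1 / (p - 1 + q / ln M)"
  proof -
    have cancel: "a * c * (b / (d * c)) = a * b / d" if "c \<noteq> 0" for a b c d :: real
      using that by simp
    show ?thesis
      unfolding growth_def
      by (subst cancel) (use assms \<open>M powr (p - 1) * M powr (1 - p) = 1\<close> in auto)
  qed
  ultimately show ?thesis by simp
qed

text \<open>The lower bound uses M directly. The upper bound is tied to a vertex, and the supremum M
  may not be attained, so vertices with values close to M are used. The limit at x follows by
  multiplying with the ratio of the two scales.\<close>

lemma tendsto_growth_lifespan:
  assumes pq: "p > 1" "q \<ge> 1" and \<psi>: "\<And>y. 0 \<le> \<psi> y" "bounded (range \<psi>)"
    and pos: "0 < \<psi> x"
  defines "M \<equiv> sup_norm \<psi>"
  shows "((\<lambda>s. ereal (growth p q (s * M)) * lifespan E w \<mu> p q (\<lambda>y. s * \<psi> y))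
      \<longlongrightarrow> ereal (1 / (p - 1))) at_top" (is ?A)
    and "((\<lambda>s. ereal (growth p q (s * \<psi> x)) * lifespan E w \<mu> p q (\<lambda>y. s * \<psi> y))
      \<longlongrightarrow> ereal ((\<psi> x / M) powr (p - 1) * (1 / (p - 1)))) at_top" (is ?B)
    and "\<psi> x \<le> M"
proof -
  let ?l = "\<lambda>s. lifespan E w \<mu> p q (\<lambda>y. s * \<psi> y)"
  have M_def': "M = (SUP y. \<psi> y)" using \<psi>(1) by (simp add: M_def sup_norm_def)
  have bdd: "bdd_above (range \<psi>)" using \<psi>(2) by (rule bounded_imp_bdd_above)
  have le_M: "\<psi> y \<le> M" for y unfolding M_def' using bdd by (intro cSUP_upper) auto
  then show "\<psi> x \<le> M" .
  have M: "M > 0" using le_M[of x] pos by simp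
  \<comment> \<open>\<open>real_of_ereal\<close> sends infinite values to 0; for large s the
    lifespan is finite, so l is then its true value.\<close>
  define l where "l s = real_of_ereal (?l s)" for s
  have large: "\<forall>\<^sub>F s in at_top. s > 0 \<and> s * \<psi> y > 1 \<and> D < growth p q (s * \<psi> y)"
    if "\<psi> y > 0" for y
  proof -
    have "filterlim (\<lambda>s. s * \<psi> y) at_top at_top"
      using that by real_asymp
    with filterlim_growth[OF pq that] show ?thesis
      by (intro eventually_conj eventually_gt_at_top) (auto simp: filterlim_at_top_dense)
  qed
  have life: "\<forall>\<^sub>F s in at_top. ?l s = ereal (l s)"
    using large[OF pos] eventually_gt_at_top[of "1 / M"]
  proof eventually_elim
    case (elim s)
    then have sM: "s * M > 1" using M by (simp add: field_simps)
    have "?l s \<noteq> \<infinity>"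
      using lifespan_le[of p q "\<lambda>y. s * \<psi> y" x] elim pq \<psi> by (auto simp: growth_def)
    moreover have "?l s \<noteq> - \<infinity>"
      using lifespan_ge[of p q "\<lambda>y. s * \<psi> y" x "s * M"] elim pq \<psi> pos le_M sM by auto
    ultimately show ?case unfolding l_def by (cases "?l s") auto
  qed
  have lower: "\<forall>\<^sub>F s in at_top. 1 / (p - 1 + q / ln (s * M)) \<le> growth p q (s * M) * l s"
    using life eventually_gt_at_top[of "1 / M"] eventually_gt_at_top[of 0]
  proof eventually_elim
    case (elim s)
    then have "s * M > 1" using M by (simp add: field_simps)
    then show ?case
      using growth_lifespan_ge[of p q "\<lambda>y. s * \<psi> y" x "s * M"] elim pq \<psi> pos le_M by simp
  qed
  have lower_lim: "((\<lambda>s. 1 / (p - 1 + q / ln (s * M))) \<longlongrightarrow> 1 / (p - 1)) at_top"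
  proof -
    have "((\<lambda>s. q / ln (s * M)) \<longlongrightarrow> 0) at_top" using M by real_asymp
    then have "((\<lambda>s. 1 / (p - 1 + q / ln (s * M))) \<longlongrightarrow> 1 / (p - 1 + 0)) at_top"
      using pq by (intro tendsto_intros) auto
    then show ?thesis by simp
  qed
  \<comment> \<open>Using the blow-up bound at y instead of at the supremum costs the limiting
    factor \<open>(M / \<psi> y) powr (p - 1)\<close>.\<close>
  have upper: "\<forall>\<^sub>F s in at_top. growth p q (s * M) * l s < c"
    if y: "\<psi> y > 0" and c: "(M / \<psi> y) powr (p - 1) * (1 / (p - 1)) < c" for y c
  proof -
    let ?G = "\<lambda>s. growth p q (s * \<psi> y)"
    have "((\<lambda>s. D / ?G s) \<longlongrightarrow> 0) at_top"
      by (intro real_tendsto_divide_at_top[OF tendsto_const] filterlim_growth pq y)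
    then have "((\<lambda>s. growth p q (s * M) / ?G s * (1 / ((p - 1) * (1 - D / ?G s))))
        \<longlongrightarrow> (M / \<psi> y) powr (p - 1) * (1 / ((p - 1) * (1 - 0)))) at_top"
      using pq y M by (intro tendsto_intros tendsto_growth_ratio) auto
    then have "\<forall>\<^sub>F s in at_top. growth p q (s * M) / ?G s * (1 / ((p - 1) * (1 - D / ?G s))) < c"
      using c by (intro order_tendstoD(2)) auto
    with large[OF y] life show ?thesis
    proof eventually_elim
      case (elim s)
      have "1 < s * M"
        using elim mult_left_mono[OF le_M[of y], of s] by linarith
      then have pos': "0 < ?G s" "0 < growth p q (s * M)" using elim growth_pos by auto
      have "?G s * l s \<le> 1 / ((p - 1) * (1 - D / ?G s))"
        using growth_lifespan_le[of p q "\<lambda>y. s * \<psi> y" y] elim pq \<psi> by simp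
      then have "growth p q (s * M) / ?G s * (?G s * l s)
          \<le> growth p q (s * M) / ?G s * (1 / ((p - 1) * (1 - D / ?G s)))"
        using pos' by (intro mult_left_mono) auto
      also have "growth p q (s * M) / ?G s * (?G s * l s) = growth p q (s * M) * l s"
        using pos' by simp
      finally show ?case using elim by simp
    qed
  qed
  have lim: "((\<lambda>s. growth p q (s * M) * l s) \<longlongrightarrow> 1 / (p - 1)) at_top"
  proof (rule order_tendstoI)
    fix c assume "c < 1 / (p - 1)"
    from order_tendstoD(1)[OF lower_lim this] lower
    show "\<forall>\<^sub>F s in at_top. c < growth p q (s * M) * l s" by eventually_elim simp
  next
    fix c assume c: "1 / (p - 1) < c"
    \<comment> \<open>This cost tends to 1 as z approaches M from below, so values near M bring the
      bound under c.\<close>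
    have "((\<lambda>z. (M / z) powr (p - 1) * (1 / (p - 1))) \<longlongrightarrow> (M / M) powr (p - 1) * (1 / (p - 1))) (at_left M)"
      using M by (intro tendsto_intros) auto
    then have "((\<lambda>z. (M / z) powr (p - 1) * (1 / (p - 1))) \<longlongrightarrow> 1 / (p - 1)) (at_left M)"
      using M by simp
    from order_tendstoD(2)[OF this c]
    obtain b where b: "b < M" "\<And>z. b < z \<Longrightarrow> z < M \<Longrightarrow> (M / z) powr (p - 1) * (1 / (p - 1)) < c"
      unfolding eventually_at_left_field by auto
    \<comment> \<open>The maximum with 0 ensures that the vertex y found next has a positive value,
      as \<open>upper\<close> requires.\<close>
    obtain z where z: "max 0 b < z" "z < M" using dense[of "max 0 b" M] b M by auto
    then obtain y where y: "z < \<psi> y" using less_cSUP_iff[OF _ bdd] M_def' by auto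
    have "(M / \<psi> y) powr (p - 1) * (1 / (p - 1)) \<le> (M / z) powr (p - 1) * (1 / (p - 1))"
      using y z M pq by (intro mult_right_mono powr_mono2 divide_left_mono) auto
    also have "\<dots> < c" using b z by auto
    finally show "\<forall>\<^sub>F s in at_top. growth p q (s * M) * l s < c"
      using y z by (intro upper) auto
  qed
  have ereal_lim: "((\<lambda>s. ereal (growth p q (s * a)) * ?l s) \<longlongrightarrow> ereal c) at_top"
    if "((\<lambda>s. growth p q (s * a) * l s) \<longlongrightarrow> c) at_top" for a c
  proof (rule Lim_transform_eventually)
    show "((\<lambda>s. ereal (growth p q (s * a) * l s)) \<longlongrightarrow> ereal c) at_top"
      using that by simp
    show "\<forall>\<^sub>F s in at_top. ereal (growth p q (s * a) * l s) = ereal (growth p q (s * a)) * ?l s"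
      using life by eventually_elim simp
  qed
  from ereal_lim[OF lim] show ?A .
  have "((\<lambda>s. growth p q (s * \<psi> x) / growth p q (s * M) * (growth p q (s * M) * l s))
      \<longlongrightarrow> (\<psi> x / M) powr (p - 1) * (1 / (p - 1))) at_top"
    by (intro tendsto_mult lim tendsto_growth_ratio pq pos M)
  then have "((\<lambda>s. growth p q (s * \<psi> x) * l s)
      \<longlongrightarrow> (\<psi> x / M) powr (p - 1) * (1 / (p - 1))) at_top"
  proof (rule Lim_transform_eventually)
    show "\<forall>\<^sub>F s in at_top. growth p q (s * \<psi> x) / growth p q (s * M) * (growth p q (s * M) * l s)
        = growth p q (s * \<psi> x) * l s"
      using eventually_gt_at_top[of "1 / M"]
    proof eventually_elim
      case (elim s)
      then have "s * M > 1" using M by (simp add: field_simps)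
      then show ?case using growth_pos[of "s * M" p q] by simp
    qed
  qed
  from ereal_lim[OF this] show ?B .
qed

end

section \<open>A real degree bound from \<open>D_mu\<close>, and the conclusion\<close>

lemma ex_degree_bounded_graph:
  assumes "weighted_graph E w \<mu>" "D_mu E w \<mu> < \<infinity>"
  shows "\<exists>D. degree_bounded_graph E w \<mu> D"
proof -
  have le: "ereal ((1 / \<mu> x) * (\<Sum>y\<in>nbrs E x. w x y)) \<le> D_mu E w \<mu>" for x
    unfolding D_mu_def by (rule SUP_upper) simp
  then obtain D where "D_mu E w \<mu> = ereal D"
    \<comment> \<open>The supremum dominates a real number, which rules out minus infinity.\<close>
    using assms(2) by (cases "D_mu E w \<mu>") force+
  then have "degree_bounded_graph E w \<mu> D"
    using le assms(1) by (simp add: degree_bounded_graph_def degree_bounded_graph_axioms_def)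
  then show ?thesis ..
qed

theorem theorem1p4:
  fixes E :: "'v \<Rightarrow> 'v \<Rightarrow> bool" and w :: "'v \<Rightarrow> 'v \<Rightarrow> real" and \<mu> :: "'v \<Rightarrow> real"
  assumes graph: "weighted_graph E w \<mu>"
    and D_finite: "D_mu E w \<mu> < \<infinity>"
  shows "\<exists>C::real. C > 0 \<and>
    (\<forall>(p::real) (q::real) (\<psi> :: 'v \<Rightarrow> real) (l::real) (x::'v).
       p > 1 \<longrightarrow> q \<ge> 1 \<longrightarrow>
       (\<forall>y. 0 \<le> \<psi> y) \<longrightarrow> bounded (range \<psi>) \<longrightarrow> (\<exists>y. \<psi> y \<noteq> 0) \<longrightarrow>
       l > 0 \<longrightarrow> deg E x \<ge> 1 \<longrightarrow>
       (l * \<psi> x) powr (p - 1) * ln (l * \<psi> x) powr q > C * real (deg E x) \<longrightarrow>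
       l * \<psi> x \<ge> 1 \<longrightarrow>
       lifespan E w \<mu> p q (\<lambda>y. l * \<psi> y) < \<infinity> \<and>
       (\<exists>L1 L2 :: real.
          ((\<lambda>s::real. ereal ((s * \<psi> x) powr (p - 1) * ln (s * \<psi> x) powr q)
                * lifespan E w \<mu> p q (\<lambda>y. s * \<psi> y)) \<longlongrightarrow> ereal L1) at_top \<and>
          ((\<lambda>s::real. ereal ((s * sup_norm \<psi>) powr (p - 1) * ln (s * sup_norm \<psi>) powr q)
                * lifespan E w \<mu> p q (\<lambda>y. s * \<psi> y)) \<longlongrightarrow> ereal L2) at_top \<and>
          L1 \<le> 1 / (p - 1) \<and> 1 / (p - 1) \<le> L2))"
proof -
  obtain D where "degree_bounded_graph E w \<mu> D"
    using ex_degree_bounded_graph[OF assms] by blast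
  then interpret degree_bounded_graph E w \<mu> D .
  \<comment> \<open>The constant is \<open>D + 1\<close>: D is fixed by the graph before all other
    data, and the summand 1 makes the constant positive. As the degree is at least 1, the hypothesis
    on x then exceeds D.\<close>
  show ?thesis
  proof (rule exI[of _ "D + 1"], intro conjI allI impI)
    show "D + 1 > 0" using D_nonneg by simp
  next
    fix p q :: real and \<psi> :: "'v \<Rightarrow> real" and l x
    assume pq: "p > 1" "q \<ge> 1" and \<psi>: "\<forall>y. 0 \<le> \<psi> y" and l: "l > 0" and deg: "deg E x \<ge> 1"
      and big: "(l * \<psi> x) powr (p - 1) * ln (l * \<psi> x) powr q > (D + 1) * real (deg E x)"
      and ge1: "l * \<psi> x \<ge> 1"
    have "(D + 1) * 1 \<le> (D + 1) * real (deg E x)"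
      using deg D_nonneg by (intro mult_left_mono) auto
    with big have D: "D + 1 < (l * \<psi> x) powr (p - 1) * ln (l * \<psi> x) powr q" by simp
    \<comment> \<open>At the value 1 the logarithm is 0 and so is its power, contradicting the
      strict lower bound.\<close>
    then have "l * \<psi> x \<noteq> 1" using D_nonneg by (intro notI) simp
    with ge1 have "l * \<psi> x > 1" by simp
    with D show "lifespan E w \<mu> p q (\<lambda>y. l * \<psi> y) < \<infinity>"
      using lifespan_le[of p q "\<lambda>y. l * \<psi> y" x] pq \<psi> l by auto
  next
    fix p q :: real and \<psi> :: "'v \<Rightarrow> real" and l x
    assume pq: "p > 1" "q \<ge> 1" and \<psi>: "\<forall>y. 0 \<le> \<psi> y" "bounded (range \<psi>)"
      and l: "l > 0" and ge1: "l * \<psi> x \<ge> 1"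
    have x: "\<psi> x > 0" using l ge1 \<psi> by (metis less_eq_real_def mult_zero_right not_one_le_zero)
    note lims = tendsto_growth_lifespan[OF pq _ \<psi>(2) x, unfolded growth_def]
    have "\<psi> x / sup_norm \<psi> \<le> 1" "0 \<le> \<psi> x / sup_norm \<psi>" using lims(3) \<psi> x by auto
    then have "(\<psi> x / sup_norm \<psi>) powr (p - 1) \<le> 1"
      using pq by (intro powr_le1) auto
    then have "(\<psi> x / sup_norm \<psi>) powr (p - 1) * (1 / (p - 1)) \<le> 1 / (p - 1)"
      using pq by (simp add: divide_right_mono)
    with lims(1,2) \<psi>
    show "\<exists>L1 L2 :: real.
          ((\<lambda>s::real. ereal ((s * \<psi> x) powr (p - 1) * ln (s * \<psi> x) powr q)
                * lifespan E w \<mu> p q (\<lambda>y. s * \<psi> y)) \<longlongrightarrow> ereal L1) at_top \<and>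
          ((\<lambda>s::real. ereal ((s * sup_norm \<psi>) powr (p - 1) * ln (s * sup_norm \<psi>) powr q)
                * lifespan E w \<mu> p q (\<lambda>y. s * \<psi> y)) \<longlongrightarrow> ereal L2) at_top \<and>
          L1 \<le> 1 / (p - 1) \<and> 1 / (p - 1) \<le> L2"
      \<comment> \<open>The second limit equals 1/(p-1) exactly; the first carries an additional
        factor at most 1, since \<open>\<psi> x\<close> does not exceed the supremum.\<close>
      by (intro exI[of _ "(\<psi> x / sup_norm \<psi>) powr (p - 1) * (1 / (p - 1))"]
          exI[of _ "1 / (p - 1)"] conjI) auto
  qed
qed

end
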